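(* Let $G$ be a 2-connected series-parallel graph and $s,t$ distinct non-adjacent vertices of $G$. Any two $st$-separators $A,B$ of $G$ with $|A|=|B|$ can be reconfigured into each other under TJ.
   Context: A 2-connected graph $G$ is series-parallel if it is the simplification (keep one edge of each set of parallel edges) of a multigraph obtained from a single edge by repeatedly applying the series operation (subdivide an edge) and the parallel operation (replace an edge by two parallel copies of it). An $st$-separator is $S\subseteq V(G)\setminus\{s,t\}$ with $s,t$ in different components of $G-S$. Under TJ, separators $S,S'$ are adjacent if $|S|=|S'|$ and $|S\setminus S'|=|S'\setminus S|=1$; $A$ can be reconfigured into $B$ if there is a sequence of $st$-separators from $A$ to $B$ with consecutive sets adjacent. *)

theory Defs
  imports "HOL-Library.Multiset" "Graph_Theory.Digraph_Component"
begin

text \<open>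
  Finite simple graphs are represented by the locale predicate \<^const>\<open>graph\<close>: finite symmetric
  digraphs without loops and without parallel arcs, in which an undirected edge is a pair of
  opposite arcs. For such digraphs the strongly connected components are the components of the
  undirected graph.
\<close>

abbreviation delete_verts :: "('a, 'b) pre_digraph \<Rightarrow> 'a set \<Rightarrow> ('a, 'b) pre_digraph" where
  "delete_verts G S \<equiv> induce_subgraph G (verts G - S)"

definition vertex_connected :: "nat \<Rightarrow> ('a, 'b) pre_digraph \<Rightarrow> bool" where
  "vertex_connected k G \<longleftrightarrow>
     card (verts G) > k \<and>
     (\<forall>X \<subseteq> verts G. card X < k \<longrightarrow> connected (delete_verts G X))"

text \<open>
  An undirected multigraph is given by its vertex set and the multiset of its edges, an edge being
  the set of its two ends. Vertices are never removed by the two operations, so drawing the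
  subdivision vertices from the vertex type of the final graph loses no generality.
\<close>

inductive series_parallel_multigraph :: "'a set \<Rightarrow> 'a set multiset \<Rightarrow> bool" where
  single_edge: "u \<noteq> v \<Longrightarrow> series_parallel_multigraph {u, v} {#{u, v}#}"
| series: "\<lbrakk>series_parallel_multigraph V M; {u, v} \<in># M; w \<notin> V\<rbrakk> \<Longrightarrow>
    series_parallel_multigraph (insert w V) (M - {#{u, v}#} + {#{u, w}, {w, v}#})"
| parallel: "\<lbrakk>series_parallel_multigraph V M; e \<in># M\<rbrakk> \<Longrightarrow>
    series_parallel_multigraph V (add_mset e M)"

definition is_simplification :: "('a, 'b) pre_digraph \<Rightarrow> 'a set \<Rightarrow> 'a set multiset \<Rightarrow> bool" where
  "is_simplification G V M \<longleftrightarrow> verts G = V \<and> arcs_ends G = {(u, v). {u, v} \<in># M}"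

definition series_parallel :: "('a, 'b) pre_digraph \<Rightarrow> bool" where
  "series_parallel G \<longleftrightarrow>
     (\<exists>V M. series_parallel_multigraph V M \<and> is_simplification G V M)"

definition separator :: "('a, 'b) pre_digraph \<Rightarrow> 'a \<Rightarrow> 'a \<Rightarrow> 'a set \<Rightarrow> bool" where
  "separator G s t S \<longleftrightarrow>
     S \<subseteq> verts G - {s, t} \<and>
     (\<exists>C \<in> pre_digraph.sccs_verts (delete_verts G S).
      \<exists>D \<in> pre_digraph.sccs_verts (delete_verts G S). s \<in> C \<and> t \<in> D \<and> C \<noteq> D)"

definition tj_adjacent :: "'a set \<Rightarrow> 'a set \<Rightarrow> bool" where
  "tj_adjacent S S' \<longleftrightarrow> card S = card S' \<and> card (S - S') = 1 \<and> card (S' - S) = 1"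

definition tj_reconfigurable ::
    "('a, 'b) pre_digraph \<Rightarrow> 'a \<Rightarrow> 'a \<Rightarrow> 'a set \<Rightarrow> 'a set \<Rightarrow> bool" where
  "tj_reconfigurable G s t A B \<longleftrightarrow>
     (\<exists>Ss. Ss \<noteq> [] \<and> hd Ss = A \<and> last Ss = B \<and>
        (\<forall>S \<in> set Ss. separator G s t S) \<and> successively tj_adjacent Ss)"

end

theory Submission
  imports Defs
begin

text \<open>
  A series-parallel multigraph is a two-terminal network built from edges by series and parallel
  composition; without a cut vertex its outermost composition is parallel, and such a network can
  be re-rooted so that either \<open>s\<close>, \<open>t\<close> are its terminals, or \<open>s\<close> and \<open>t\<close> lie inside two
  networks glued in parallel at a pair \<open>p\<close>, \<open>q\<close>. In both cases there is a separator \<open>X\<close> such that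
  every separator can be moved to a superset of \<open>X\<close>, after which the remaining tokens are free.
  If \<open>s\<close>, \<open>t\<close> are the terminals, \<open>X\<close> takes one cut vertex of each parallel branch. Otherwise
  \<open>X = {p, q}\<close>: a set that shields \<open>s\<close> from \<open>p\<close> and \<open>q\<close> inside its network is pushed outwards
  through the nested compositions until it contains both.
\<close>

section \<open>Connections avoiding a vertex set\<close>

text \<open>Walks whose vertices avoid \<open>A\<close>, except that the trivial walk is allowed
  everywhere, even at a vertex of \<open>A\<close>. End points inside \<open>A\<close> therefore
  need separate care.\<close>

definition linked :: "'a set multiset \<Rightarrow> 'a set \<Rightarrow> 'a \<Rightarrow> 'a \<Rightarrow> bool" where
  "linked M A = (\<lambda>x y. {x, y} \<in># M \<and> x \<notin> A \<and> y \<notin> A)\<^sup>*\<^sup>*"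

lemma linked_refl [simp]: "linked M A x x"
  by (simp add: linked_def)

lemma linked_edge: "{x, y} \<in># M \<Longrightarrow> x \<notin> A \<Longrightarrow> y \<notin> A \<Longrightarrow> linked M A x y"
  by (auto simp: linked_def)

lemma linked_trans: "linked M A x y \<Longrightarrow> linked M A y z \<Longrightarrow> linked M A x z"
  by (auto simp: linked_def)

lemma linked_induct [consumes 1, case_names base step]:
  assumes "linked M A x y" and "Q x"
    and "\<And>y z. linked M A x y \<Longrightarrow> {y, z} \<in># M \<Longrightarrow> y \<notin> A \<Longrightarrow> z \<notin> A \<Longrightarrow> Q y \<Longrightarrow> Q z"
  shows "Q y"
  using assms(1) unfolding linked_def
  by (induction rule: rtranclp_induct) (use assms in \<open>auto simp: linked_def\<close>)

lemma linked_sym: "linked M A x y \<Longrightarrow> linked M A y x"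
proof (induction rule: linked_induct)
  case (step y z)
  then have "linked M A z y" by (intro linked_edge) (simp_all add: insert_commute)
  then show ?case using step.IH by (rule linked_trans)
qed simp

text \<open>Serves two purposes: with \<open>V = UNIV\<close> it is monotonicity in edges and
  blocked vertices; with \<open>V\<close> the vertices of one piece, tokens off that piece may
  change freely.\<close>

lemma linked_mono:
  assumes "linked M A x y" and "set_mset M \<subseteq> set_mset M'"
    and "\<And>e. e \<in># M \<Longrightarrow> e \<subseteq> V" and "A' \<inter> V \<subseteq> A"
  shows "linked M' A' x y"
  using assms(1)
proof (induction rule: linked_induct)
  case (step y z)
  then have "linked M' A' y z"
    using assms by (intro linked_edge) auto
  with step show ?case by (blast intro: linked_trans)
qed simp

lemma linked_stays:
  assumes "linked M A x y" and "\<And>e. e \<in># M \<Longrightarrow> e \<subseteq> V" and "x \<in> V"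
  shows "y \<in> V"
  using assms(1) by (induction rule: linked_induct) (use assms in auto)

section \<open>Walks in pieces glued at shared vertices\<close>

text \<open>A walk leaves the first piece only through an unblocked shared vertex, and
  \<open>s\<close> reaches none of these within \<open>M1\<close>.\<close>

lemma linked_glue_isolated:
  assumes "linked (M1 + M2) A s x"
    and "\<And>e. e \<in># M1 \<Longrightarrow> e \<subseteq> V1" and "\<And>e. e \<in># M2 \<Longrightarrow> e \<subseteq> V2" and "s \<in> V1"
    and "\<And>k. k \<in> V1 \<inter> V2 \<Longrightarrow> k \<notin> A \<Longrightarrow> \<not> linked M1 A s k"
  shows "linked M1 A s x"
  using assms(1)
proof (induction rule: linked_induct)
  case (step y z)
  have y: "y \<in> V1" using linked_stays[OF step.IH] assms by blast
  have "{y, z} \<in># M1"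
  proof (rule ccontr)
    assume "{y, z} \<notin># M1"
    then have "y \<in> V2" using step assms(3) by auto
    with y step assms(5) show False by blast
  qed
  then show ?case using step by (blast intro: linked_trans linked_edge)
qed simp

text \<open>An excursion into the second piece leaves and returns through \<open>r\<close>, so it
  can be cut out of the walk.\<close>

lemma linked_glue_vertex:
  assumes "linked (M1 + M2) A x y"
    and "\<And>e. e \<in># M1 \<Longrightarrow> e \<subseteq> V1" and "\<And>e. e \<in># M2 \<Longrightarrow> e \<subseteq> V2" and "V1 \<inter> V2 = {r}"
    and "x \<in> V1" and "y \<in> V1"
  shows "linked M1 A x y"
proof -
  \<comment> \<open>Invariant for the moving end: inside \<open>V2\<close> it only records that
    \<open>r\<close> was reached within \<open>M1\<close>.\<close>
  have "(y \<in> V1 \<and> linked M1 A x y) \<or> (y \<in> V2 \<and> linked M1 A x r)"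
    using assms(1)
  proof (induction rule: linked_induct)
    case (step y z)
    show ?case
    proof (cases "{y, z} \<in># M1")
      case True
      then have "y \<in> V1" "z \<in> V1" using assms(2) by auto
      moreover have "linked M1 A y z" using True step by (intro linked_edge)
      moreover have "linked M1 A x y"
        using step.IH \<open>y \<in> V1\<close> assms(4) by auto
      ultimately show ?thesis by (blast intro: linked_trans)
    next
      case False
      then have "{y, z} \<in># M2" using step by auto
      then have "y \<in> V2" "z \<in> V2" using assms(3) by auto
      moreover from this have "y = r" if "y \<in> V1" using that assms(4) by blast
      ultimately show ?thesis using step.IH by metis
    qed
  qed (use assms in simp)
  moreover have "y = r" if "y \<in> V2" using that assms by blast
  ultimately show ?thesis by blast
qed

text \<open>Between the last visit to \<open>p\<close> before the first visit to \<open>q\<close>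
  and that visit to \<open>q\<close>, the walk meets no further shared vertex and so cannot change
  sides.\<close>

lemma linked_glue_pair:
  assumes "linked (M1 + M2) A p q"
    and "\<And>e. e \<in># M1 \<Longrightarrow> e \<subseteq> V1" and "\<And>e. e \<in># M2 \<Longrightarrow> e \<subseteq> V2" and "V1 \<inter> V2 = {p, q}"
  shows "linked M1 A p q \<or> linked M2 A p q"
proof (rule ccontr)
  assume no: "\<not> ?thesis"
  have p: "p \<in> V1" "p \<in> V2" using assms(4) by auto
  have "linked M1 A p q \<or> linked M2 A p q"
    using assms(1)
  proof (induction rule: linked_induct)
    case (step y z)
    then have yz: "{y, z} \<in># M1 \<or> {y, z} \<in># M2" by auto
    \<comment> \<open>A change of sides happens at a shared vertex: at \<open>p\<close> the walk
      starts afresh, and \<open>q\<close> is excluded by \<open>no\<close>.\<close>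
    have "y = p \<or> (linked M1 A p y \<and> {y, z} \<in># M1) \<or> (linked M2 A p y \<and> {y, z} \<in># M2)"
    proof (rule ccontr)
      assume c: "\<not> ?thesis"
      have "y \<in> V1 \<inter> V2"
      proof (cases "{y, z} \<in># M1")
        case True
        then have "y \<in> V1" using assms(2) by auto
        moreover have "linked M2 A p y" using c True step.IH by blast
        then have "y \<in> V2" using linked_stays assms(3) p by metis
        ultimately show ?thesis by simp
      next
        case False
        then have "y \<in> V2" using yz assms(3) by auto
        moreover have "linked M1 A p y" using c False yz step.IH by blast
        then have "y \<in> V1" using linked_stays assms(2) p by metis
        ultimately show ?thesis by simp
      qed
      then have "y = q" using c assms(4) by auto
      then show False using step.IH no by simp
    qed
    then show ?case using step yz by (metis linked_edge linked_trans linked_refl)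
  qed simp
  then show False using no by blast
qed

section \<open>Two-terminal series-parallel networks\<close>

text \<open>Decomposition trees: the rules compose whole networks instead of altering single edges,
  which provides the structural induction used below.\<close>

inductive sp_network :: "'a set \<Rightarrow> 'a set multiset \<Rightarrow> 'a \<Rightarrow> 'a \<Rightarrow> bool" where
  edge: "p \<noteq> q \<Longrightarrow> sp_network {p, q} {#{p, q}#} p q"
| series: "sp_network V1 M1 p r \<Longrightarrow> sp_network V2 M2 r q \<Longrightarrow> V1 \<inter> V2 = {r} \<Longrightarrow>
    sp_network (V1 \<union> V2) (M1 + M2) p q"
| parallel: "sp_network V1 M1 p q \<Longrightarrow> sp_network V2 M2 p q \<Longrightarrow> V1 \<inter> V2 = {p, q} \<Longrightarrow>
    sp_network (V1 \<union> V2) (M1 + M2) p q"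

lemma sp_network_terminals:
  assumes "sp_network V M p q"
  shows "p \<in> V" and "q \<in> V" and "p \<noteq> q"
  using assms by (induction rule: sp_network.induct) auto

lemma sp_network_edge_subset: "sp_network V M p q \<Longrightarrow> e \<in># M \<Longrightarrow> e \<subseteq> V"
  by (induction rule: sp_network.induct) auto

lemma sp_network_sym: "sp_network V M p q \<Longrightarrow> sp_network V M q p"
proof (induction rule: sp_network.induct)
  case (edge p q)
  then show ?case using sp_network.edge[of q p] by (simp add: insert_commute)
next
  case (series V1 M1 p r V2 M2 q)
  then show ?case using sp_network.series[of V2 M2 q r V1 M1 p] by (simp add: ac_simps)
next
  case (parallel V1 M1 p q V2 M2)
  then show ?case using sp_network.parallel[of V1 M1 q p V2 M2] by (simp add: insert_commute)
qed

lemma sp_network_linked_terminal: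
  "sp_network V M p q \<Longrightarrow> A \<inter> V = {} \<Longrightarrow> x \<in> V \<Longrightarrow> linked M A p x"
proof (induction arbitrary: x rule: sp_network.induct)
  case (edge p q)
  then show ?case by (auto intro: linked_edge)
next
  case (series V1 M1 p r V2 M2 q)
  have lift: "linked (M1 + M2) A u v" if "linked M1 A u v \<or> linked M2 A u v" for u v
    using that linked_mono[where V = UNIV and M' = "M1 + M2" and A' = A and A = A] by auto
  have "r \<in> V1" using series.hyps by auto
  then have "linked (M1 + M2) A p r" using series by (intro lift) auto
  moreover have "linked (M1 + M2) A p x \<or> linked (M1 + M2) A r x"
    using series lift by blast
  ultimately show ?case by (blast intro: linked_trans)
next
  case (parallel V1 M1 p q V2 M2)
  have lift: "linked (M1 + M2) A u v" if "linked M1 A u v \<or> linked M2 A u v" for u v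
    using that linked_mono[where V = UNIV and M' = "M1 + M2" and A' = A and A = A] by auto
  show ?case using parallel by (intro lift) blast
qed

lemma sp_network_linked:
  assumes "sp_network V M p q" and "A \<inter> V = {}" and "x \<in> V" and "y \<in> V"
  shows "linked M A x y"
  using assms by (blast intro: linked_trans linked_sym sp_network_linked_terminal)

section \<open>Multigraph operations as changes of one leaf\<close>

text \<open>Only one leaf carrying the edge changes, into a series composition of two edges. Since
  \<open>w\<close> is new, the intersections of vertex sets stay the same.\<close>

lemma sp_network_subdivide:
  assumes "sp_network V M p q" and "{u, v} \<in># M" and "w \<notin> V"
  shows "sp_network (insert w V) (M - {#{u, v}#} + {#{u, w}, {w, v}#}) p q"
  using assms
proof (induction rule: sp_network.induct)
  case (edge p q)
  then have "u = p \<and> v = q \<or> u = q \<and> v = p" by (auto simp: doubleton_eq_iff)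
  moreover have "sp_network (insert w {p, q}) {#{p, w}, {w, q}#} p q"
  proof -
    have w: "p \<noteq> w" "w \<noteq> q" "{p, w} \<inter> {w, q} = {w}" "{p, w} \<union> {w, q} = insert w {p, q}"
      using edge.prems(2) edge.hyps by auto
    show ?thesis
      using sp_network.series[OF sp_network.edge[OF w(1)] sp_network.edge[OF w(2)] w(3)]
      unfolding w(4) by (simp add: add_mset_commute)
  qed
  moreover have "{#{q, w}, {w, p}#} = {#{p, w}, {w, q}#}"
    by (simp add: add_mset_commute insert_commute)
  moreover have "{#{p, q}#} - {#{u, v}#} = {#}" using edge by simp
  ultimately show ?case by auto
next
  case (series V1 M1 p r V2 M2 q)
  let ?P = "{#{u, w}, {w, v}#}"
  show ?case
  proof (cases "{u, v} \<in># M1")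
    case True
    then have "sp_network (insert w V1 \<union> V2) ((M1 - {#{u, v}#} + ?P) + M2) p q"
      using series by (intro sp_network.series) auto
    then show ?thesis using True by (simp add: ac_simps)
  next
    case False
    then have "{u, v} \<in># M2" using series by auto
    then have "sp_network (V1 \<union> insert w V2) (M1 + (M2 - {#{u, v}#} + ?P)) p q"
      using series by (intro sp_network.series) auto
    then show ?thesis using \<open>{u, v} \<in># M2\<close> by (simp add: ac_simps)
  qed
next
  case (parallel V1 M1 p q V2 M2)
  let ?P = "{#{u, w}, {w, v}#}"
  show ?case
  proof (cases "{u, v} \<in># M1")
    case True
    then have "sp_network (insert w V1 \<union> V2) ((M1 - {#{u, v}#} + ?P) + M2) p q"
      using parallel by (intro sp_network.parallel) auto
    then show ?thesis using True by (simp add: ac_simps)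
  next
    case False
    then have "{u, v} \<in># M2" using parallel by auto
    then have "sp_network (V1 \<union> insert w V2) (M1 + (M2 - {#{u, v}#} + ?P)) p q"
      using parallel by (intro sp_network.parallel) auto
    then show ?thesis using \<open>{u, v} \<in># M2\<close> by (simp add: ac_simps)
  qed
qed

text \<open>One leaf carrying the edge becomes two parallel copies of it on the same two
  vertices.\<close>

lemma sp_network_duplicate:
  "sp_network V M p q \<Longrightarrow> e \<in># M \<Longrightarrow> sp_network V (add_mset e M) p q"
proof (induction rule: sp_network.induct)
  case (edge p q)
  then show ?case
    using sp_network.parallel[OF sp_network.edge[of p q] sp_network.edge[of p q]] by simp
next
  case (series V1 M1 p r V2 M2 q)
  then show ?case
    using sp_network.series[of V1 "add_mset e M1" p r V2 M2 q]
      sp_network.series[of V1 M1 p r V2 "add_mset e M2" q] by auto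
next
  case (parallel V1 M1 p q V2 M2)
  then show ?case
    using sp_network.parallel[of V1 "add_mset e M1" p q V2 M2]
      sp_network.parallel[of V1 M1 p q V2 "add_mset e M2"] by auto
qed

lemma series_parallel_multigraph_network:
  "series_parallel_multigraph V M \<Longrightarrow> \<exists>p q. sp_network V M p q"
proof (induction rule: series_parallel_multigraph.induct)
  case (single_edge u v)
  then show ?case by (blast intro: sp_network.edge)
next
  case (series V M u v w)
  then show ?case by (blast intro: sp_network_subdivide)
next
  case (parallel V M e)
  then show ?case by (blast intro: sp_network_duplicate)
qed

section \<open>Re-rooting a network at a given pair of vertices\<close>

definition split_at_pair ::
    "'a set \<Rightarrow> 'a set multiset \<Rightarrow> 'a \<Rightarrow> 'a \<Rightarrow> bool" where
  "split_at_pair V M s t \<longleftrightarrow>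
     (\<exists>p q V1 M1 V2 M2. sp_network V1 M1 p q \<and> sp_network V2 M2 p q \<and> V1 \<inter> V2 = {p, q} \<and>
        V = V1 \<union> V2 \<and> M = M1 + M2 \<and> s \<in> V1 - {p, q} \<and> t \<in> V2 - {p, q})"

lemma split_at_pairI:
  assumes "sp_network V1 M1 p q" and "sp_network V2 M2 p q" and "V1 \<inter> V2 = {p, q}"
    and "V = V1 \<union> V2" and "M = M1 + M2" and "s \<in> V1 - {p, q}" and "t \<in> V2 - {p, q}"
  shows "split_at_pair V M s t"
  using assms unfolding split_at_pair_def by blast

lemma split_at_pair_sym: "split_at_pair V M s t \<Longrightarrow> split_at_pair V M t s"
proof -
  assume "split_at_pair V M s t"
  then obtain p q V1 M1 V2 M2 where "sp_network V1 M1 p q" "sp_network V2 M2 p q"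
      "V1 \<inter> V2 = {p, q}" "V = V1 \<union> V2" "M = M1 + M2" "s \<in> V1 - {p, q}" "t \<in> V2 - {p, q}"
    unfolding split_at_pair_def by blast
  then show ?thesis by (intro split_at_pairI[of V2 M2 p q V1 M1]) (simp_all add: ac_simps)
qed

text \<open>A parallel composition is a cycle of two networks; moving material of the first network
  into the second one re-roots the decomposition until it fits the pair \<open>s\<close>, \<open>t\<close>.\<close>

lemma reroot_parallel:
  assumes "sp_network V1 M1 p q" and "sp_network V2 M2 p q" and "V1 \<inter> V2 = {p, q}"
    and "s \<in> V1" and "t \<in> V1" and "s \<noteq> t"
  shows "sp_network (V1 \<union> V2) (M1 + M2) s t \<or> split_at_pair (V1 \<union> V2) (M1 + M2) s t"
  using assms
proof (induction arbitrary: V2 M2 rule: sp_network.induct)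
  case (edge p q)
  then have net: "sp_network ({p, q} \<union> V2) ({#{p, q}#} + M2) p q"
    by (intro sp_network.parallel sp_network.edge)
  have "s = p \<and> t = q \<or> s = q \<and> t = p" using edge by auto
  then show ?case using net sp_network_sym[OF net] by blast
next
  case (series Va Ma p r Vb Mb q)
  note T = sp_network_terminals[OF series.hyps(1)] sp_network_terminals[OF series.hyps(2)]
  have pb: "p \<notin> Vb" and qa: "q \<notin> Va" using T series.hyps(3) by (metis IntI singletonD)+
  have ia2: "Va \<inter> V2 = {p}" and ib2: "Vb \<inter> V2 = {q}"
    using series.prems(2) T pb qa by (simp_all add: set_eq_iff) metis+
  have ia: "Va \<inter> (Vb \<union> V2) = {p, r}" and ib: "Vb \<inter> (Va \<union> V2) = {r, q}"
    using ia2 ib2 series.hyps(3) by (simp_all add: Int_Un_distrib Int_commute insert_commute)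
  \<comment> \<open>The rest of the cycle, \<open>Vb\<close> followed by the outer network, joins
    \<open>r\<close> to \<open>p\<close>; it replaces \<open>V2\<close> in the induction hypothesis
    for \<open>Va\<close>.\<close>
  have na: "sp_network (Vb \<union> V2) (Mb + M2) p r"
    using sp_network_sym[OF sp_network.series[OF series.hyps(2) sp_network_sym[OF series.prems(1)] ib2]] .
  have nb: "sp_network (Va \<union> V2) (Ma + M2) r q"
    using sp_network.series[OF sp_network_sym[OF series.hyps(1)] series.prems(1) ia2] .
  have ea: "Va \<union> Vb \<union> V2 = Va \<union> (Vb \<union> V2)" "Ma + Mb + M2 = Ma + (Mb + M2)"
    by (auto simp: ac_simps)
  have eb: "Va \<union> Vb \<union> V2 = Vb \<union> (Va \<union> V2)" "Ma + Mb + M2 = Mb + (Ma + M2)"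
    by (auto simp: ac_simps)
  \<comment> \<open>With the vertices in different parts, \<open>x \<noteq> p\<close> makes
    \<open>x\<close> inner to \<open>Va\<close>, and \<open>y \<noteq> q\<close> makes
    \<open>y\<close> inner to \<open>Vb\<close>; either one gives a split. If both fail, they are
    the terminals of the whole.\<close>
  have split: "x = p \<and> y = q \<or> split_at_pair (Va \<union> Vb \<union> V2) (Ma + Mb + M2) x y"
    if "x \<in> Va - {r}" "y \<in> Vb - {r}" for x y
  proof -
    have *: "split_at_pair (Va \<union> Vb \<union> V2) (Ma + Mb + M2) x y" if "x \<noteq> p"
      using series.hyps(1) na ia ea
      by (rule split_at_pairI) (use \<open>x \<in> _\<close> \<open>y \<in> _\<close> that pb in auto)
    have "split_at_pair (Va \<union> Vb \<union> V2) (Ma + Mb + M2) y x" if "y \<noteq> q"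
      using series.hyps(2) nb ib eb
      by (rule split_at_pairI) (use \<open>x \<in> _\<close> \<open>y \<in> _\<close> that qa in auto)
    with * show ?thesis using split_at_pair_sym by metis
  qed
  have top: "sp_network (Va \<union> Vb \<union> V2) (Ma + Mb + M2) p q"
    using sp_network.parallel[OF sp_network.series[OF series.hyps] series.prems(1,2)] .
  consider "s \<in> Va" "t \<in> Va" | "s \<in> Vb" "t \<in> Vb"
    | "s \<in> Va - {r}" "t \<in> Vb - {r}" | "s \<in> Vb - {r}" "t \<in> Va - {r}"
    using series.prems series.hyps(3) by blast
  then show ?case
  proof cases
    case 1
    then show ?thesis unfolding ea by (intro series.IH(1)[OF na ia] series.prems(5))
  next
    case 2
    then show ?thesis unfolding eb by (intro series.IH(2)[OF nb ib] series.prems(5))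
  next
    case 3
    then show ?thesis using split top by blast
  next
    case 4
    then show ?thesis using split top sp_network_sym split_at_pair_sym by metis
  qed
next
  case (parallel Va Ma p q Vb Mb)
  have i: "Va \<inter> V2 = {p, q}" "Vb \<inter> V2 = {p, q}"
    using parallel.prems(2) sp_network_terminals[OF parallel.hyps(1)]
      sp_network_terminals[OF parallel.hyps(2)]
    by (simp_all add: set_eq_iff) metis+
  have na: "sp_network (Vb \<union> V2) (Mb + M2) p q"
    using sp_network.parallel[OF parallel.hyps(2) parallel.prems(1) i(2)] .
  have nb: "sp_network (Va \<union> V2) (Ma + M2) p q"
    using sp_network.parallel[OF parallel.hyps(1) parallel.prems(1) i(1)] .
  have ia: "Va \<inter> (Vb \<union> V2) = {p, q}" and ib: "Vb \<inter> (Va \<union> V2) = {p, q}"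
    using parallel.hyps(3) i by (simp_all add: Int_Un_distrib Int_commute)
  have ea: "Va \<union> Vb \<union> V2 = Va \<union> (Vb \<union> V2)" "Ma + Mb + M2 = Ma + (Mb + M2)"
    by (auto simp: ac_simps)
  have eb: "Va \<union> Vb \<union> V2 = Vb \<union> (Va \<union> V2)" "Ma + Mb + M2 = Mb + (Ma + M2)"
    by (auto simp: ac_simps)
  have split: "split_at_pair (Va \<union> Vb \<union> V2) (Ma + Mb + M2) x y"
    if "x \<in> Va - {p, q}" "y \<in> Vb - {p, q}" for x y
    using parallel.hyps(1) na ia ea by (rule split_at_pairI) (use that in auto)
  consider "s \<in> Va" "t \<in> Va" | "s \<in> Vb" "t \<in> Vb"
    | "s \<in> Va - {p, q}" "t \<in> Vb - {p, q}" | "s \<in> Vb - {p, q}" "t \<in> Va - {p, q}"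
    using parallel.prems parallel.hyps(3) by blast
  then show ?case
  proof cases
    case 1
    then show ?thesis unfolding ea by (intro parallel.IH(1)[OF na ia] parallel.prems(5))
  next
    case 2
    then show ?thesis unfolding eb by (intro parallel.IH(2)[OF nb ib] parallel.prems(5))
  next
    case 3
    then show ?thesis using split by blast
  next
    case 4
    then show ?thesis using split split_at_pair_sym by metis
  qed
qed

text \<open>A single edge has too few vertices, and the middle vertex of an outermost series
  composition would be a cut vertex. The outermost composition is thus parallel: one branch contains
  both vertices and is re-rooted, or they are inner to different branches.\<close>

lemma sp_network_without_cutvertex_cases:
  assumes net: "sp_network V M p q" and "card V > 2"
    and conn: "\<And>r x y. x \<in> V - {r} \<Longrightarrow> y \<in> V - {r} \<Longrightarrow> linked M {r} x y"
    and st: "s \<in> V" "t \<in> V" "s \<noteq> t"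
  shows "sp_network V M s t \<or> split_at_pair V M s t"
  using net
proof cases
  case edge
  then show ?thesis using \<open>card V > 2\<close> by (simp add: card_insert_if)
next
  case (series V1 M1 r V2 M2)
  note T = sp_network_terminals[OF series(3)] sp_network_terminals[OF series(4)]
  have "linked (M1 + M2) {r} p q" using conn[of p r q] T series by auto
  then have "linked M1 {r} p q"
    by (rule linked_glue_isolated[OF _ sp_network_edge_subset[OF series(3)]
          sp_network_edge_subset[OF series(4)]]) (use T series in auto)
  then have "q \<in> V1" using linked_stays sp_network_edge_subset[OF series(3)] T by metis
  then show ?thesis using T series(5) by (metis IntI singletonD)
next
  case (parallel V1 M1 V2 M2)
  consider "s \<in> V1" "t \<in> V1" | "s \<in> V2" "t \<in> V2"
    | "s \<in> V1 - {p, q}" "t \<in> V2 - {p, q}" | "s \<in> V2 - {p, q}" "t \<in> V1 - {p, q}"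
    using st parallel by blast
  then show ?thesis
  proof cases
    case 1
    then show ?thesis using reroot_parallel[OF parallel(3-5)] st parallel by simp
  next
    case 2
    have "V2 \<inter> V1 = {p, q}" using parallel by auto
    from reroot_parallel[OF parallel(4,3) this 2] st parallel
    show ?thesis by (simp add: ac_simps)
  next
    case 3
    then show ?thesis using split_at_pairI[OF parallel(3-5,1,2)] by blast
  next
    case 4
    then show ?thesis using split_at_pairI[OF parallel(3-5,1,2)] split_at_pair_sym by metis
  qed
qed

section \<open>Token jumping\<close>

text \<open>The predicate is a parameter because runs found for a subnetwork are transferred to the
  whole. Naming the token that moves makes preservation of size automatic for finite sets.\<close>

definition jump :: "('a set \<Rightarrow> bool) \<Rightarrow> 'a set \<Rightarrow> 'a set \<Rightarrow> bool" where
  "jump P A B \<longleftrightarrow> P A \<and> P B \<and> (\<exists>a b. a \<in> A \<and> b \<notin> A \<and> B = insert b (A - {a}))"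

lemma jumpI: "P A \<Longrightarrow> a \<in> A \<Longrightarrow> b \<notin> A \<Longrightarrow> P (insert b (A - {a})) \<Longrightarrow> jump P A (insert b (A - {a}))"
  unfolding jump_def by blast

lemma jump_sym: "jump P A B \<Longrightarrow> jump P B A"
proof -
  assume "jump P A B"
  then obtain a b where *: "P A" "P B" "a \<in> A" "b \<notin> A" "B = insert b (A - {a})"
    unfolding jump_def by blast
  then have "b \<in> B" "a \<notin> B" "A = insert a (B - {b})" by auto
  with * show ?thesis unfolding jump_def by blast
qed

lemma jumps_sym: "(jump P)\<^sup>*\<^sup>* A B \<Longrightarrow> (jump P)\<^sup>*\<^sup>* B A"
  by (induction rule: rtranclp_induct) (auto intro: converse_rtranclp_into_rtranclp jump_sym)

lemma jumps_mono:
  assumes "(jump P)\<^sup>*\<^sup>* A B" and "\<And>C. P C \<Longrightarrow> Q C"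
  shows "(jump Q)\<^sup>*\<^sup>* A B"
  using assms(1) by (rule rtranclp_mono[THEN predicate2D, rotated]) (use assms(2) in \<open>auto simp: jump_def\<close>)

lemma jumps_invariant: "(jump P)\<^sup>*\<^sup>* A B \<Longrightarrow> P A \<Longrightarrow> P B"
  by (induction rule: rtranclp_induct) (auto simp: jump_def)

lemma jumps_card: "(jump P)\<^sup>*\<^sup>* A B \<Longrightarrow> finite A \<Longrightarrow> finite B \<and> card B = card A"
proof (induction rule: rtranclp_induct)
  case (step B C)
  then show ?case
    by (auto simp: jump_def card_insert_if card_Diff_singleton) (metis Suc_pred card_gt_0_iff empty_iff)
qed simp

text \<open>The tokens of \<open>C\<close> stand still while the others move; this allows treating
  parallel branches one after the other.\<close>

lemma jumps_frame:
  assumes "(jump P)\<^sup>*\<^sup>* A B" and "\<And>X. P X \<Longrightarrow> X \<inter> C = {} \<and> Q (X \<union> C)"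
  shows "(jump Q)\<^sup>*\<^sup>* (A \<union> C) (B \<union> C)"
  using assms(1)
proof (induction rule: rtranclp_induct)
  case (step X Y)
  then obtain a b where *: "P X" "P Y" "a \<in> X" "b \<notin> X" "Y = insert b (X - {a})"
    unfolding jump_def by blast
  then have "X \<inter> C = {}" "Y \<inter> C = {}" "Q (X \<union> C)" "Q (Y \<union> C)" using assms(2) by blast+
  moreover from this * have "Y \<union> C = insert b ((X \<union> C) - {a})" "b \<notin> X \<union> C" by auto
  ultimately have "jump Q (X \<union> C) (Y \<union> C)"
    using * unfolding jump_def by blast
  with step.IH show ?case by simp
qed simp

text \<open>Tokens of \<open>A - B\<close> move one at a time into \<open>B - A\<close>. Those on
  \<open>X\<close> never move, so each intermediate set still contains \<open>X\<close>.\<close>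

lemma jumps_between_supersets:
  assumes "finite A" and "finite B" and "card A = card B" and "X \<subseteq> A" and "X \<subseteq> B"
    and "\<And>C. X \<subseteq> C \<Longrightarrow> C \<subseteq> A \<union> B \<Longrightarrow> P C"
  shows "(jump P)\<^sup>*\<^sup>* A B"
  using assms
proof (induction "card (A - B)" arbitrary: A)
  case 0
  then have "A \<subseteq> B" by auto
  then have "A = B" using 0 card_subset_eq by blast
  then show ?case by simp
next
  case (Suc n)
  then obtain a where a: "a \<in> A" "a \<notin> B" by (metis Diff_iff card.empty equals0I nat.simps(3))
  have "\<not> B \<subseteq> A" using Suc.prems a card_subset_eq by metis
  then obtain b where b: "b \<in> B" "b \<notin> A" by blast
  let ?C = "insert b (A - {a})"
  have "?C - B = (A - B) - {a}" using b by auto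
  then have n: "n = card (?C - B)" using Suc.hyps(2) Suc.prems(1) a by simp
  have card: "card ?C = card B"
    using Suc.prems a b by (simp add: card_Diff_singleton) (metis card_gt_0_iff Suc_pred)
  have "(jump P)\<^sup>*\<^sup>* ?C B"
    using n _ _ card
  proof (rule Suc.hyps(1))
    show "P D" if "X \<subseteq> D" "D \<subseteq> ?C \<union> B" for D
      using that b by (intro Suc.prems(6)) blast+
  qed (use Suc.prems a in auto)
  moreover have "jump P A ?C"
  proof (rule jumpI[OF _ a(1) b(2)])
    show "P A" using Suc.prems(4,6) by blast
    show "P ?C" using Suc.prems(4,5) a b by (intro Suc.prems(6)) blast+
  qed
  ultimately show ?case by simp
qed

section \<open>Separators in networks\<close>

text \<open>The set \<open>W\<close> holds the positions open to tokens; tokens may also lie off the network.\<close>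

definition isolating :: "'a set \<Rightarrow> 'a set multiset \<Rightarrow> 'a \<Rightarrow> 'a set \<Rightarrow> 'a set \<Rightarrow> bool" where
  "isolating W M s T A \<longleftrightarrow> A \<subseteq> W \<and> (\<forall>x \<in> T - A. \<not> linked M A s x)"

section \<open>Shielding one vertex from the terminals\<close>

text \<open>The series step of the induction, stated for \<open>s\<close> in the first part and
  reused with the parts reversed. If \<open>s\<close> is already shielded within its own part, the
  induction hypothesis occupies \<open>p\<close> and \<open>r\<close>, and \<open>r\<close> is
  traded for \<open>q\<close>. Otherwise \<open>s\<close> reaches \<open>r\<close>, so each of
  \<open>q\<close> and \<open>p\<close> that is still free can receive a token from the part it
  bounds.\<close>

lemma isolating_series:
  assumes n1: "sp_network V1 M1 p r" and n2: "sp_network V2 M2 r q" and V: "V1 \<inter> V2 = {r}"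
    and s: "s \<in> V1 - {p}" and W: "s \<notin> W" "V1 \<union> V2 - {s} \<subseteq> W"
    and A: "isolating W (M1 + M2) s {p, q} A"
    and IH: "\<And>A. s \<noteq> r \<Longrightarrow> isolating W M1 s {p, r} A \<Longrightarrow>
      \<exists>B. (jump (isolating W M1 s {p, r}))\<^sup>*\<^sup>* A B \<and> p \<in> B \<and> r \<in> B"
  shows "\<exists>B. (jump (isolating W (M1 + M2) s {p, q}))\<^sup>*\<^sup>* A B \<and> p \<in> B \<and> q \<in> B"
proof -
  let ?P = "isolating W (M1 + M2) s {p, q}"
  note T = sp_network_terminals[OF n1] sp_network_terminals[OF n2]
  note E1 = sp_network_edge_subset[OF n1] and E2 = sp_network_edge_subset[OF n2]
  have pq: "p \<notin> V2" "q \<notin> V1" using T V by (metis IntI singletonD)+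
  have in_W: "p \<in> W" "q \<in> W" using T W s pq by blast+
  have both: "?P C" if "C \<subseteq> W" "p \<in> C" "q \<in> C" for C
    using that by (simp add: isolating_def)
  have lift1: "linked (M1 + M2) C x y" if "linked M1 C x y" for C x y
    using that by (rule linked_mono[where V = UNIV]) auto
  have lift2: "linked (M1 + M2) C x y" if "linked M2 C x y" for C x y
    using that by (rule linked_mono[where V = UNIV]) auto
  have W_A: "A \<subseteq> W" using A by (simp add: isolating_def)
  show ?thesis
  proof (cases "s \<noteq> r \<and> isolating W M1 s {p, r} A")
    case True
    have imp: "?P C" if "isolating W M1 s {p, r} C" for C
    proof -
      have "linked M1 C s x" if "linked (M1 + M2) C s x" for x
        using that by (rule linked_glue_isolated[OF _ E1 E2])
          (use \<open>isolating W M1 s {p, r} C\<close> s V in \<open>auto simp: isolating_def\<close>)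
      moreover have "\<not> linked M1 C s q"
        using linked_stays[of M1 C s q V1] E1 s pq by blast
      ultimately show ?thesis using that unfolding isolating_def by blast
    qed
    obtain B where B: "(jump (isolating W M1 s {p, r}))\<^sup>*\<^sup>* A B" "p \<in> B" "r \<in> B"
      using IH True by blast
    have AB: "(jump ?P)\<^sup>*\<^sup>* A B" using jumps_mono[OF B(1) imp] .
    then have PB: "?P B" using jumps_invariant A by blast
    show ?thesis
    proof (cases "q \<in> B")
      case True
      then show ?thesis using AB B by blast
    next
      case False
      have "jump ?P B (insert q (B - {r}))"
        using PB B False T in_W by (intro jumpI[of ?P, OF PB] both) (auto simp: isolating_def)
      then have "(jump ?P)\<^sup>*\<^sup>* A (insert q (B - {r}))" using AB by simp
      then show ?thesis using B T by blast
    qed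
  next
    case False
    \<comment> \<open>The leak in the first part is at \<open>r\<close>, because the whole set
      shields \<open>s\<close> from \<open>p\<close>.\<close>
    have sr: "linked M1 A s r \<and> r \<notin> A"
    proof (cases "s = r")
      case True
      then show ?thesis using W_A W by auto
    next
      case False
      then obtain x where "x \<in> {p, r} - A" "linked M1 A s x"
        using \<open>\<not> (s \<noteq> r \<and> _)\<close> W_A unfolding isolating_def by blast
      moreover from this have "x \<noteq> p" using A lift1 unfolding isolating_def by blast
      ultimately show ?thesis by auto
    qed
    have "\<exists>B. (jump ?P)\<^sup>*\<^sup>* A B \<and> q \<in> B"
    proof (cases "q \<in> A")
      case True
      then show ?thesis by blast
    next
      case False
      \<comment> \<open>As \<open>s\<close> reaches \<open>r\<close>, a second part free of tokens
        would let it reach \<open>q\<close>.\<close>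
      have "A \<inter> V2 \<noteq> {}"
      proof
        assume "A \<inter> V2 = {}"
        then have "linked M2 A r q" using n2 T by (blast intro: sp_network_linked)
        then have "linked (M1 + M2) A s q" using sr lift1 lift2 linked_trans by metis
        then show False using A False unfolding isolating_def by blast
      qed
      then obtain a where a: "a \<in> A" "a \<in> V2" by blast
      then have "a \<notin> V1" using sr V by (metis IntI singletonD)
      let ?C = "insert q (A - {a})"
      \<comment> \<open>Lifting \<open>a\<close> opens no way to \<open>p\<close>: a walk from
        \<open>s\<close> to \<open>p\<close> can be confined to the first part, which does not
        contain \<open>a\<close>.\<close>
      have "\<not> linked (M1 + M2) ?C s p" if "p \<notin> ?C"
      proof
        assume "linked (M1 + M2) ?C s p"
        then have "linked M1 ?C s p"
          by (rule linked_glue_vertex[OF _ E1 E2 V]) (use s T in auto)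
        then have "linked M1 A s p"
          by (rule linked_mono[OF _ _ E1]) (use \<open>a \<notin> V1\<close> in auto)
        moreover have "p \<notin> A" using that a pq by auto
        ultimately show False using A lift1 unfolding isolating_def by blast
      qed
      then have "?P ?C" using W_A in_W unfolding isolating_def by blast
      then have "jump ?P A ?C" using A a False by (intro jumpI)
      then show ?thesis by blast
    qed
    then obtain B where AB: "(jump ?P)\<^sup>*\<^sup>* A B" and q: "q \<in> B" by blast
    then have PB: "?P B" using jumps_invariant A by blast
    show ?thesis
    proof (cases "p \<in> B")
      case True
      then show ?thesis using AB q by blast
    next
      case False
      \<comment> \<open>With \<open>q\<close> occupied, any token of the first part may go to
        \<open>p\<close>, since occupying both terminals already isolates.\<close>
      have "B \<inter> V1 \<noteq> {}"
      proof
        assume "B \<inter> V1 = {}"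
        then have "linked M1 B s p" using n1 T s by (blast intro: sp_network_linked)
        then show False using PB False lift1 unfolding isolating_def by blast
      qed
      then obtain b where b: "b \<in> B" "b \<in> V1" by blast
      then have "jump ?P B (insert p (B - {b}))"
        using PB False q pq in_W by (intro jumpI[of ?P, OF PB] both) (auto simp: isolating_def)
      then have "(jump ?P)\<^sup>*\<^sup>* A (insert p (B - {b}))" using AB by simp
      moreover have "q \<in> insert p (B - {b})" using b q pq by auto
      ultimately show ?thesis by blast
    qed
  qed
qed

text \<open>The second network is entered only through \<open>p\<close> or \<open>q\<close>, and
  \<open>s\<close> reaches neither, so shielding within its own branch is enough.\<close>

lemma isolating_parallel:
  assumes n1: "sp_network V1 M1 p q" and n2: "sp_network V2 M2 p q" and V: "V1 \<inter> V2 = {p, q}"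
    and s: "s \<in> V1 - {p, q}" and C: "isolating W M1 s {p, q} C"
    and x: "linked (M1 + M2) C s x"
  shows "x \<in> V1 - {p, q}"
proof -
  note E1 = sp_network_edge_subset[OF n1] and E2 = sp_network_edge_subset[OF n2]
  have no: "\<not> linked M1 C s k" if "k \<in> {p, q}" "k \<notin> C" for k
    using that C by (auto simp: isolating_def)
  have l: "linked M1 C s x"
    using x by (rule linked_glue_isolated[OF _ E1 E2]) (use V s no in auto)
  then have "x \<in> V1" using linked_stays[of M1 C s x V1] E1 s by blast
  \<comment> \<open>Only a trivial walk can end in \<open>C\<close>; this excludes terminals that
    carry a token.\<close>
  moreover have "x \<notin> C \<or> x = s"
    using l by (induction rule: linked_induct) auto
  ultimately show ?thesis using no l s by blast
qed

text \<open>Induction over the decomposition with \<open>W\<close> fixed while the network shrinks.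
  An edge has no inner vertex, and in a parallel composition isolation in the whole and in the
  branch of \<open>s\<close> coincide.\<close>

lemma isolating_jumps_to_terminals:
  assumes "sp_network V M p q" and "s \<in> V - {p, q}" and "s \<notin> W" and "V - {s} \<subseteq> W"
    and "isolating W M s {p, q} A"
  shows "\<exists>B. (jump (isolating W M s {p, q}))\<^sup>*\<^sup>* A B \<and> p \<in> B \<and> q \<in> B"
  using assms
proof (induction arbitrary: A rule: sp_network.induct)
  case (edge p q)
  then show ?case by simp
next
  case (series V1 M1 p r V2 M2 q)
  note T = sp_network_terminals[OF series.hyps(1)] sp_network_terminals[OF series.hyps(2)]
  \<comment> \<open>The case \<open>s = r\<close> is assigned to the first part;
    \<open>isolating_series\<close> handles it without its induction hypothesis.\<close>
  consider "s \<in> V1 - {p}" | "s \<in> V2 - {q}" "s \<noteq> r"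
    using series.prems series.hyps T by blast
  then show ?case
  proof cases
    case 1
    show ?thesis
      using series.hyps 1 series.prems(2,3,4)
      by (rule isolating_series) (use 1 series.prems in \<open>auto intro!: series.IH(1)\<close>)
  next
    case 2
    have "V2 \<inter> V1 = {r}" using series.hyps(3) by auto
    have "\<exists>B. (jump (isolating W (M2 + M1) s {q, p}))\<^sup>*\<^sup>* A B \<and> q \<in> B \<and> p \<in> B"
    proof (rule isolating_series[OF sp_network_sym[OF series.hyps(2)]
          sp_network_sym[OF series.hyps(1)] \<open>V2 \<inter> V1 = {r}\<close> 2(1) series.prems(2)])
      show "V2 \<union> V1 - {s} \<subseteq> W" using series.prems by auto
      show "isolating W (M2 + M1) s {q, p} A"
        using series.prems(4) by (simp add: ac_simps insert_commute)
      fix A assume "isolating W M2 s {q, r} A"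
      then have "isolating W M2 s {r, q} A" by (simp add: insert_commute)
      then have "\<exists>B. (jump (isolating W M2 s {r, q}))\<^sup>*\<^sup>* A B \<and> r \<in> B \<and> q \<in> B"
        using 2 series.prems by (intro series.IH(2)) auto
      then show "\<exists>B. (jump (isolating W M2 s {q, r}))\<^sup>*\<^sup>* A B \<and> q \<in> B \<and> r \<in> B"
        by (auto simp: insert_commute)
    qed
    then show ?thesis by (auto simp: insert_commute ac_simps)
  qed
next
  case (parallel V1 M1 p q V2 M2)
  have inner: "\<exists>B. (jump (isolating W (M1 + M2) s {p, q}))\<^sup>*\<^sup>* A B \<and> p \<in> B \<and> q \<in> B"
    if n: "sp_network V1 M1 p q" "sp_network V2 M2 p q" "V1 \<inter> V2 = {p, q}" "s \<in> V1 - {p, q}"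
      "isolating W (M1 + M2) s {p, q} A"
      and IH: "\<And>A. isolating W M1 s {p, q} A \<Longrightarrow>
        \<exists>B. (jump (isolating W M1 s {p, q}))\<^sup>*\<^sup>* A B \<and> p \<in> B \<and> q \<in> B"
    for V1 M1 V2 M2
  proof -
    have "linked (M1 + M2) A s x" if "linked M1 A s x" for x
      using that by (rule linked_mono[where V = UNIV]) auto
    then have "isolating W M1 s {p, q} A"
      using n(5) unfolding isolating_def by blast
    then obtain B where B: "(jump (isolating W M1 s {p, q}))\<^sup>*\<^sup>* A B" "p \<in> B" "q \<in> B"
      using IH by blast
    have "isolating W (M1 + M2) s {p, q} C" if "isolating W M1 s {p, q} C" for C
      using isolating_parallel[OF n(1-4) that] that unfolding isolating_def by blast
    then show ?thesis using jumps_mono[OF B(1)] B by blast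
  qed
  show ?case
  proof (cases "s \<in> V1")
    case True
    have W: "V1 - {s} \<subseteq> W" using parallel.prems(3) by blast
    show ?thesis
      using parallel.hyps _ parallel.prems(4) parallel.IH(1)[OF _ parallel.prems(2) W]
      by (rule inner) (use True parallel.prems(1) in auto)
  next
    case False
    have W: "V2 - {s} \<subseteq> W" and s: "s \<in> V2 - {p, q}"
      using parallel.prems(1,3) False by blast+
    have "\<exists>B. (jump (isolating W (M2 + M1) s {p, q}))\<^sup>*\<^sup>* A B \<and> p \<in> B \<and> q \<in> B"
      using parallel.hyps(2,1) _ s _ parallel.IH(2)[OF s parallel.prems(2) W]
      by (rule inner) (use parallel.hyps(3) parallel.prems(4) in \<open>auto simp: ac_simps\<close>)
    then show ?thesis by (simp add: ac_simps)
  qed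
qed

section \<open>Cuts between two vertices of a network\<close>

definition st_cut :: "'a set \<Rightarrow> 'a set multiset \<Rightarrow> 'a \<Rightarrow> 'a \<Rightarrow> 'a set \<Rightarrow> bool" where
  "st_cut V M s t A \<longleftrightarrow> A \<subseteq> V - {s, t} \<and> \<not> linked M A s t"

lemma st_cut_sym: "st_cut V M s t = st_cut V M t s"
  by (auto simp: st_cut_def fun_eq_iff intro: linked_sym)

lemma st_cut_superset: "st_cut V M s t X \<Longrightarrow> X \<subseteq> A \<Longrightarrow> A \<subseteq> V - {s, t} \<Longrightarrow> st_cut V M s t A"
  unfolding st_cut_def using linked_mono[where V = UNIV and M = M and M' = M and A = A and A' = X] by blast

lemma isolating_imp_cut:
  assumes "sp_network V1 M1 p q" and "sp_network V2 M2 p q" and "V1 \<inter> V2 = {p, q}"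
    and "s \<in> V1 - {p, q}" and "t \<in> V2 - {p, q}"
    and "isolating (V1 \<union> V2 - {s, t}) M1 s {p, q} A"
  shows "st_cut (V1 \<union> V2) (M1 + M2) s t A"
proof -
  have "t \<notin> V1" using assms by auto
  then have "\<not> linked (M1 + M2) A s t" using isolating_parallel[OF assms(1-4,6)] by blast
  then show ?thesis using assms(6) by (simp add: st_cut_def isolating_def)
qed

lemma isolating_jumps_to_pair:
  assumes n: "sp_network V1 M1 p q" "sp_network V2 M2 p q" "V1 \<inter> V2 = {p, q}"
    and st: "s \<in> V1 - {p, q}" "t \<in> V2 - {p, q}"
    and A: "isolating (V1 \<union> V2 - {s, t}) M1 s {p, q} A"
  shows "\<exists>B. (jump (st_cut (V1 \<union> V2) (M1 + M2) s t))\<^sup>*\<^sup>* A B \<and> {p, q} \<subseteq> B"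
proof -
  obtain B where B: "(jump (isolating (V1 \<union> V2 - {s, t}) M1 s {p, q}))\<^sup>*\<^sup>* A B" "p \<in> B" "q \<in> B"
    using isolating_jumps_to_terminals[OF n(1) st(1) _ _ A] n st by blast
  moreover have "(jump (st_cut (V1 \<union> V2) (M1 + M2) s t))\<^sup>*\<^sup>* A B"
    using B(1) by (rule jumps_mono) (rule isolating_imp_cut[OF n st])
  ultimately show ?thesis by blast
qed

text \<open>If neither side of the pair isolates, one of \<open>p\<close>, \<open>q\<close> is reached from \<open>s\<close> only and the other
  from \<open>t\<close> only; a single jump to the latter makes the side of \<open>t\<close> isolating.\<close>

lemma cut_jumps_to_pair:
  assumes n: "sp_network V1 M1 p q" "sp_network V2 M2 p q" "V1 \<inter> V2 = {p, q}"
    and st: "s \<in> V1 - {p, q}" "t \<in> V2 - {p, q}"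
    and A: "st_cut (V1 \<union> V2) (M1 + M2) s t A"
  shows "\<exists>B. (jump (st_cut (V1 \<union> V2) (M1 + M2) s t))\<^sup>*\<^sup>* A B \<and> {p, q} \<subseteq> B"
proof -
  let ?V = "V1 \<union> V2" and ?M = "M1 + M2"
  let ?W = "?V - {s, t}"
  have n': "V2 \<inter> V1 = {p, q}" using n by auto
  have eq: "st_cut (V2 \<union> V1) (M2 + M1) t s = st_cut ?V ?M s t" "V2 \<union> V1 - {t, s} = ?W"
    by (subst st_cut_sym) (auto simp: ac_simps)
  have lift1: "linked ?M C x y" if "linked M1 C x y" for C x y
    using that by (rule linked_mono[where V = UNIV]) auto
  have lift2: "linked ?M C x y" if "linked M2 C x y" for C x y
    using that by (rule linked_mono[where V = UNIV]) auto
  have side_t: "st_cut ?V ?M s t C \<and> (\<exists>B. (jump (st_cut ?V ?M s t))\<^sup>*\<^sup>* C B \<and> {p, q} \<subseteq> B)"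
    if "isolating ?W M2 t {p, q} C" for C
    using isolating_jumps_to_pair[OF n(2,1) n' st(2,1), unfolded eq, OF that]
      isolating_imp_cut[OF n(2,1) n' st(2,1), unfolded eq, OF that] by blast
  have W_A: "A \<subseteq> ?W" and sep: "\<not> linked ?M A s t" using A by (auto simp: st_cut_def)
  consider "isolating ?W M1 s {p, q} A" | "isolating ?W M2 t {p, q} A"
    | x y where "x \<in> {p, q} - A" "linked M1 A s x" "y \<in> {p, q} - A" "linked M2 A t y"
    using W_A unfolding isolating_def by blast
  then show ?thesis
  proof cases
    case 1
    then show ?thesis by (rule isolating_jumps_to_pair[OF n st])
  next
    case 2
    then show ?thesis using side_t by blast
  next
    case (3 x y)
    have not_t: "\<not> linked M2 A t x"
      using 3 sep lift1 lift2 linked_sym linked_trans by metis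
    then have "x \<noteq> y" using 3 by blast
    then have xy: "{p, q} = {x, y}" using 3 by auto
    \<comment> \<open>Otherwise the first network would join \<open>x\<close> to \<open>y\<close>,
      and hence \<open>s\<close> to \<open>t\<close>.\<close>
    have "A \<inter> V1 \<noteq> {}"
    proof
      assume "A \<inter> V1 = {}"
      then have "linked M1 A x y" using n 3 by (blast intro: sp_network_linked)
      then show False using 3 sep lift1 lift2 linked_sym linked_trans by metis
    qed
    then obtain a where a: "a \<in> A" "a \<in> V1" by blast
    have "a \<notin> V2"
    proof
      assume "a \<in> V2"
      then have "a \<in> {x, y}" using a(2) n(3) xy by (metis IntI)
      then show False using a(1) 3 by blast
    qed
    \<comment> \<open>The token on \<open>a\<close> lies outside \<open>V2\<close>, so lifting it
      opens nothing there; with \<open>y\<close> occupied and \<open>x\<close> still out of reach,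
      \<open>t\<close> is isolated.\<close>
    let ?C = "insert y (A - {a})"
    have "\<not> linked M2 ?C t x"
    proof
      assume "linked M2 ?C t x"
      then have "linked M2 A t x"
        by (rule linked_mono[OF _ _ sp_network_edge_subset[OF n(2)]]) (use \<open>a \<notin> V2\<close> in auto)
      then show False using not_t by blast
    qed
    moreover have "y \<in> ?W"
      using 3(3) sp_network_terminals[OF n(1)] st
      by (metis DiffE DiffI UnI1 insertE insertI1 insertI2 singletonD)
    ultimately have C: "isolating ?W M2 t {p, q} ?C"
      using W_A xy unfolding isolating_def by auto
    have "jump (st_cut ?V ?M s t) A ?C"
      using A a 3 side_t[OF C] by (intro jumpI) auto
    then show ?thesis using side_t[OF C] by (meson converse_rtranclp_into_rtranclp)
  qed
qed

text \<open>In a series composition the middle vertex is the attractor: by connectedness every cut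
  has a token, and any token may go there. In a parallel composition the attractors of the branches
  are united. A single edge is ruled out, since its terminals are adjacent.\<close>

lemma network_cut_attractor:
  assumes "sp_network V M p q" and "{p, q} \<notin># M"
  shows "\<exists>X. st_cut V M p q X \<and>
    (\<forall>A. st_cut V M p q A \<longrightarrow> (\<exists>B. (jump (st_cut V M p q))\<^sup>*\<^sup>* A B \<and> X \<subseteq> B))"
  using assms
proof (induction rule: sp_network.induct)
  case (edge p q)
  then show ?case by simp
next
  case (series V1 M1 p r V2 M2 q)
  let ?c = "st_cut (V1 \<union> V2) (M1 + M2) p q"
  note T = sp_network_terminals[OF series.hyps(1)] sp_network_terminals[OF series.hyps(2)]
  note E1 = sp_network_edge_subset[OF series.hyps(1)]
    and E2 = sp_network_edge_subset[OF series.hyps(2)]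
  have net: "sp_network (V1 \<union> V2) (M1 + M2) p q" using sp_network.series[OF series.hyps] .
  have "\<not> linked (M1 + M2) {r} p q"
  proof
    assume "linked (M1 + M2) {r} p q"
    then have "linked M1 {r} p q"
      by (rule linked_glue_isolated[OF _ E1 E2]) (use T series.hyps in auto)
    then have "q \<in> V1" using linked_stays[of M1 _ p q V1] E1 T by blast
    then show False using T series.hyps(3) by (metis IntI singletonD)
  qed
  then have r: "?c {r}" using T unfolding st_cut_def by auto
  moreover have "\<exists>B. (jump ?c)\<^sup>*\<^sup>* A B \<and> {r} \<subseteq> B" if A: "?c A" for A
  proof (cases "r \<in> A")
    case True
    then show ?thesis by blast
  next
    case False
    have "A \<inter> (V1 \<union> V2) \<noteq> {}"
      using A sp_network_linked_terminal[OF net, of A q] T unfolding st_cut_def by blast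
    then obtain a where a: "a \<in> A" by blast
    have "?c (insert r (A - {a}))"
      using A r by (intro st_cut_superset[OF r]) (auto simp: st_cut_def)
    then have "jump ?c A (insert r (A - {a}))" using A a False by (intro jumpI)
    then show ?thesis by blast
  qed
  ultimately show ?case by blast
next
  case (parallel V1 M1 p q V2 M2)
  let ?c = "st_cut (V1 \<union> V2) (M1 + M2) p q" and ?c1 = "st_cut V1 M1 p q" and ?c2 = "st_cut V2 M2 p q"
  note E1 = sp_network_edge_subset[OF parallel.hyps(1)]
    and E2 = sp_network_edge_subset[OF parallel.hyps(2)]
  obtain X1 where X1: "?c1 X1" "\<And>A. ?c1 A \<Longrightarrow> \<exists>B. (jump ?c1)\<^sup>*\<^sup>* A B \<and> X1 \<subseteq> B"
    using parallel by auto
  obtain X2 where X2: "?c2 X2" "\<And>A. ?c2 A \<Longrightarrow> \<exists>B. (jump ?c2)\<^sup>*\<^sup>* A B \<and> X2 \<subseteq> B"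
    using parallel by auto
  \<comment> \<open>Cuts of the branches avoid the shared terminals, so they are disjoint and do not
    interfere.\<close>
  have join: "A1 \<inter> A2 = {} \<and> ?c (A1 \<union> A2)" if "?c1 A1" "?c2 A2" for A1 A2
  proof -
    have d: "A1 \<inter> V2 = {}" "A2 \<inter> V1 = {}" "A1 \<inter> A2 = {}"
      using that parallel.hyps(3) unfolding st_cut_def by blast+
    have "\<not> linked M1 (A1 \<union> A2) p q"
      using that(1) linked_mono[OF _ _ E1, of M1 "A1 \<union> A2" p q M1 A1] unfolding st_cut_def by auto
    moreover have "\<not> linked M2 (A1 \<union> A2) p q"
      using that(2) linked_mono[OF _ _ E2, of M2 "A1 \<union> A2" p q M2 A2] unfolding st_cut_def by auto
    ultimately have "\<not> linked (M1 + M2) (A1 \<union> A2) p q"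
      using linked_glue_pair[OF _ E1 E2 parallel.hyps(3)] by blast
    then show ?thesis using that d unfolding st_cut_def by auto
  qed
  have "\<exists>B. (jump ?c)\<^sup>*\<^sup>* A B \<and> X1 \<union> X2 \<subseteq> B" if A: "?c A" for A
  proof -
    let ?A1 = "A \<inter> V1" and ?A2 = "A \<inter> V2"
    have "linked (M1 + M2) A p q" if "linked M1 ?A1 p q"
      using that by (rule linked_mono[OF _ _ E1]) auto
    moreover have "linked (M1 + M2) A p q" if "linked M2 ?A2 p q"
      using that by (rule linked_mono[OF _ _ E2]) auto
    ultimately have c: "?c1 ?A1" "?c2 ?A2" using A unfolding st_cut_def by auto
    obtain B1 where B1: "(jump ?c1)\<^sup>*\<^sup>* ?A1 B1" "X1 \<subseteq> B1" using X1(2)[OF c(1)] by blast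
    obtain B2 where B2: "(jump ?c2)\<^sup>*\<^sup>* ?A2 B2" "X2 \<subseteq> B2" using X2(2)[OF c(2)] by blast
    have cB: "?c1 B1" using jumps_invariant[OF B1(1) c(1)] .
    \<comment> \<open>First the tokens of the first branch move while the second rests, then the
      roles are exchanged.\<close>
    have "(jump ?c)\<^sup>*\<^sup>* (?A1 \<union> ?A2) (B1 \<union> ?A2)"
      using B1(1) by (rule jumps_frame) (use join c in blast)
    moreover have "(jump ?c)\<^sup>*\<^sup>* (?A2 \<union> B1) (B2 \<union> B1)"
      using B2(1)
    proof (rule jumps_frame)
      show "X \<inter> B1 = {} \<and> ?c (X \<union> B1)" if "?c2 X" for X
        using join[OF cB that] by (simp add: ac_simps)
    qed
    moreover have "?A1 \<union> ?A2 = A" using A unfolding st_cut_def by auto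
    moreover have "?A2 \<union> B1 = B1 \<union> ?A2" by auto
    ultimately have "(jump ?c)\<^sup>*\<^sup>* A (B2 \<union> B1)" by simp
    then show ?thesis using B1 B2 by blast
  qed
  then show ?case using join X1 X2 by blast
qed

text \<open>Both cuts move to supersets of \<open>X\<close>; these are joined through supersets of
  \<open>X\<close>, and the run from \<open>B\<close> is reversed.\<close>

lemma jumps_via_attractor:
  assumes "finite V" and X: "st_cut V M s t X"
    and attr: "\<And>A. st_cut V M s t A \<Longrightarrow> \<exists>B. (jump (st_cut V M s t))\<^sup>*\<^sup>* A B \<and> X \<subseteq> B"
    and AB: "st_cut V M s t A" "st_cut V M s t B" "card A = card B"
  shows "(jump (st_cut V M s t))\<^sup>*\<^sup>* A B"
proof -
  let ?c = "st_cut V M s t"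
  obtain A' B' where A': "(jump ?c)\<^sup>*\<^sup>* A A'" "X \<subseteq> A'" and B': "(jump ?c)\<^sup>*\<^sup>* B B'" "X \<subseteq> B'"
    using attr AB by meson
  have fin: "finite A" "finite B"
    using AB \<open>finite V\<close> unfolding st_cut_def by (auto intro: finite_subset)
  have c: "?c A'" "?c B'" using jumps_invariant A' B' AB by blast+
  have "(jump ?c)\<^sup>*\<^sup>* A' B'"
  proof (rule jumps_between_supersets[where X = X])
    show "finite A'" "finite B'" "card A' = card B'"
      using jumps_card[OF A'(1) fin(1)] jumps_card[OF B'(1) fin(2)] AB by auto
    show "?c C" if "X \<subseteq> C" "C \<subseteq> A' \<union> B'" for C
      using X that(1) by (rule st_cut_superset) (use that c in \<open>auto simp: st_cut_def\<close>)
  qed (use A' B' in auto)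
  then show ?thesis using A'(1) jumps_sym[OF B'(1)] by (meson rtranclp_trans)
qed

section \<open>Separators of graphs\<close>

lemma adj_delete_verts_iff:
  "(u, v) \<in> arcs_ends (delete_verts G A) \<longleftrightarrow>
    (u, v) \<in> arcs_ends G \<and> u \<in> verts G - A \<and> v \<in> verts G - A"
  by (auto simp: arcs_ends_def arc_to_ends_def)

text \<open>Reachability depends only on which edges occur, so the multiplicities forgotten by the
  simplification do not affect it.\<close>

lemma reachable_delete_verts_iff:
  assumes wf: "wf_digraph G" and "is_simplification G V M" and "x \<in> V - A"
  shows "x \<rightarrow>\<^sup>*\<^bsub>delete_verts G A\<^esub> y \<longleftrightarrow> y \<in> V - A \<and> linked M A x y"
proof -
  have adj: "(u, v) \<in> arcs_ends (delete_verts G A) \<longleftrightarrow> {u, v} \<in># M \<and> u \<in> V - A \<and> v \<in> V - A" for u v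
    using assms(2) by (auto simp: adj_delete_verts_iff is_simplification_def)
  have "y \<in> V - A \<and> linked M A x y" if "x \<rightarrow>\<^sup>*\<^bsub>delete_verts G A\<^esub> y"
    using that unfolding reachable_def
  proof (induction rule: rtrancl_on_induct)
    case base
    then show ?case using assms by simp
  next
    case (step y z)
    then show ?case using adj by (meson DiffE linked_edge linked_trans)
  qed
  moreover have "y \<in> V - A \<longrightarrow> x \<rightarrow>\<^sup>*\<^bsub>delete_verts G A\<^esub> y" if "linked M A x y"
    using that
  proof (induction rule: linked_induct)
    case base
    then show ?case using assms by (simp add: reachable_def is_simplification_def)
  next
    case (step y z)
    have "(y, z) \<in> arcs_ends G" using step assms(2) by (simp add: is_simplification_def)
    then have "y \<in> V" "z \<in> V"
      using assms(2) wf_digraph.adj_in_verts[OF wf] by (auto simp: is_simplification_def)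
    then show ?case
      using step adj[of y z] assms(2)
      unfolding reachable_def is_simplification_def
      by (auto intro: rtrancl_on_into_rtrancl_on)
  qed
  ultimately show ?thesis by blast
qed

lemma separator_iff_cut:
  assumes "graph G" and simp: "is_simplification G V M" and "s \<in> V" and "t \<in> V"
  shows "separator G s t A \<longleftrightarrow> st_cut V M s t A"
proof -
  interpret graph G by fact
  let ?H = "delete_verts G A"
  interpret H: wf_digraph ?H by (rule wellformed_induce_subgraph)
  have V: "verts G = V" using simp by (simp add: is_simplification_def)
  note reach = reachable_delete_verts_iff[OF wf_digraph_axioms simp]
  show ?thesis
  proof
    assume "separator G s t A"
    then obtain C D where CD: "A \<subseteq> V - {s, t}" "C \<in> H.sccs_verts" "D \<in> H.sccs_verts"
        "s \<in> C" "t \<in> D" "C \<noteq> D"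
      unfolding separator_def V by blast
    have "t \<notin> C" using H.sccs_verts_disjoint[OF CD(2,3,6)] CD by blast
    have "\<not> linked M A s t"
    proof
      assume "linked M A s t"
      then have "s \<rightarrow>\<^sup>*\<^bsub>?H\<^esub> t" "t \<rightarrow>\<^sup>*\<^bsub>?H\<^esub> s"
        using reach[of s A t] reach[of t A s] linked_sym[of M A s t] CD(1) assms by auto
      then show False using CD(2,4) \<open>t \<notin> C\<close> unfolding H.in_sccs_verts_conv_reachable by blast
    qed
    then show "st_cut V M s t A" using CD by (simp add: st_cut_def)
  next
    assume c: "st_cut V M s t A"
    \<comment> \<open>The components of the remaining graph are the classes of
      \<open>linked\<close>.\<close>
    define comp where "comp x = {y \<in> V - A. linked M A x y}" for x
    have scc: "comp x \<in> H.sccs_verts" "x \<in> comp x" if "x \<in> V - A" for x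
    proof -
      show "x \<in> comp x" using that by (simp add: comp_def)
      then show "comp x \<in> H.sccs_verts"
        unfolding H.in_sccs_verts_conv_reachable
        using reach by (auto simp: comp_def intro: linked_sym linked_trans)
    qed
    have "s \<in> V - A" "t \<in> V - A" "t \<notin> comp s"
      using c assms by (auto simp: st_cut_def comp_def)
    then show "separator G s t A"
      using scc c unfolding separator_def V st_cut_def by blast
  qed
qed

lemma vertex_connected_2_linked:
  assumes "graph G" and simp: "is_simplification G V M" and "vertex_connected 2 G"
    and xy: "x \<in> V - {r}" "y \<in> V - {r}"
  shows "linked M {r} x y"
proof -
  interpret graph G by fact
  let ?H = "delete_verts G {r}"
  interpret H: wf_digraph ?H by (rule wellformed_induce_subgraph)
  have V: "verts G = V" using simp by (simp add: is_simplification_def)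
  \<comment> \<open>The vertex \<open>r\<close> may lie outside the graph, whereas connectivity
    speaks of subsets of its vertices.\<close>
  have del: "?H = delete_verts G ({r} \<inter> V)"
    by (rule arg_cong[where f = "induce_subgraph G"]) (auto simp: V)
  have "card ({r} \<inter> V) < 2"
    by (rule le_less_trans[OF card_mono[of "{r}"]]) auto
  moreover have "{r} \<inter> V \<subseteq> verts G" using V by simp
  ultimately have "connected ?H"
    using assms(3) unfolding vertex_connected_def by (metis del)
  \<comment> \<open>Connectedness is defined through the symmetric closure, which here adds no
    reachability.\<close>
  moreover have "symmetric ?H"
    using sym_arcs by (simp add: symmetric_def sym_def adj_delete_verts_iff)
  ultimately have "x \<rightarrow>\<^sup>*\<^bsub>?H\<^esub> y"
    using xy V H.reachable_mk_symmetric_eq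
    by (auto simp: connected_def strongly_connected_def)
  then show ?thesis
    using reachable_delete_verts_iff[OF wf_digraph_axioms simp] xy by blast
qed

section \<open>From jumps to sequences of separators\<close>

lemma jumps_imp_tj_sequence:
  assumes "(jump P)\<^sup>*\<^sup>* A B" and "P A" and "finite A"
  shows "\<exists>Ss. Ss \<noteq> [] \<and> hd Ss = A \<and> last Ss = B \<and> (\<forall>S \<in> set Ss. P S) \<and>
    successively tj_adjacent Ss"
  using assms
proof (induction rule: converse_rtranclp_induct)
  case base
  then show ?case by (intro exI[of _ "[B]"]) simp
next
  case (step A C)
  from step.hyps(1) obtain a b where *: "P A" "P C" "a \<in> A" "b \<notin> A" "C = insert b (A - {a})"
    unfolding jump_def by blast
  then have "A - C = {a}" "C - A = {b}" by auto
  moreover have "card C = card A"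
    using jumps_card[of P A C] step by auto
  ultimately have adj: "tj_adjacent A C" by (simp add: tj_adjacent_def)
  obtain Ss where "Ss \<noteq> []" "hd Ss = C" "last Ss = B" "\<forall>S \<in> set Ss. P S"
      "successively tj_adjacent Ss"
    using step.IH * step.prems by auto
  then show ?case
    using adj * by (intro exI[of _ "A # Ss"]) (auto simp: successively_Cons)
qed

theorem theorem6:
  fixes G :: "('a, 'b) pre_digraph" and s t :: 'a and A B :: "'a set"
  assumes "graph G"
    and "vertex_connected 2 G"
    and "series_parallel G"
    and "s \<in> verts G" and "t \<in> verts G" and "s \<noteq> t"
    and "\<not> s \<rightarrow>\<^bsub>G\<^esub> t"
    and "separator G s t A" and "separator G s t B"
    and "card A = card B"
  shows "tj_reconfigurable G s t A B"
proof -
  interpret graph G by fact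
  obtain V M where sp: "series_parallel_multigraph V M" and simp: "is_simplification G V M"
    using assms(3) unfolding series_parallel_def by blast
  have V: "verts G = V" using simp by (simp add: is_simplification_def)
  then have fin: "finite V" using finite_verts by simp
  have st: "s \<in> V" "t \<in> V" using assms V by auto
  have non_adj: "{s, t} \<notin># M" using assms(7) simp by (simp add: is_simplification_def)
  let ?c = "st_cut V M s t"
  have sep: "separator G s t = ?c"
    using separator_iff_cut[OF assms(1) simp st] by blast
  obtain p q where "sp_network V M p q"
    using series_parallel_multigraph_network[OF sp] by blast
  then have "sp_network V M s t \<or> split_at_pair V M s t"
    using assms(2) V st assms(6) vertex_connected_2_linked[OF assms(1) simp assms(2)]
    by (intro sp_network_without_cutvertex_cases) (auto simp: vertex_connected_def)
  then have "\<exists>X. ?c X \<and> (\<forall>A. ?c A \<longrightarrow> (\<exists>B. (jump ?c)\<^sup>*\<^sup>* A B \<and> X \<subseteq> B))"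
  proof
    assume "sp_network V M s t"
    then show ?thesis using non_adj by (rule network_cut_attractor)
  next
    assume "split_at_pair V M s t"
    then obtain p q V1 M1 V2 M2 where n: "sp_network V1 M1 p q" "sp_network V2 M2 p q"
        "V1 \<inter> V2 = {p, q}" and eq: "V = V1 \<union> V2" "M = M1 + M2"
      and int: "s \<in> V1 - {p, q}" "t \<in> V2 - {p, q}"
      unfolding split_at_pair_def by blast
    \<comment> \<open>A set containing both terminals isolates vacuously, so the pair itself is a
      cut.\<close>
    have "isolating (V1 \<union> V2 - {s, t}) M1 s {p, q} {p, q}"
      using n(3) int by (auto simp: isolating_def)
    then have "?c {p, q}" using isolating_imp_cut[OF n int] eq by simp
    moreover have "\<exists>B. (jump ?c)\<^sup>*\<^sup>* A B \<and> {p, q} \<subseteq> B" if "?c A" for A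
      using cut_jumps_to_pair[OF n int] that eq by simp
    ultimately show ?thesis by blast
  qed
  then have "(jump ?c)\<^sup>*\<^sup>* A B"
    using jumps_via_attractor[OF fin] assms(8-10) sep by metis
  moreover have "?c A" using assms(8) sep by simp
  moreover from this have "finite A" using fin by (auto simp: st_cut_def intro: finite_subset)
  ultimately show ?thesis
    unfolding tj_reconfigurable_def sep by (rule jumps_imp_tj_sequence)
qed

end
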